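(* Consider the system $$\dot x=(J-R)\nabla H(x)+gu,\qquad y=g^T\nabla H(x),$$ where $J,R,g$ are constant (state-independent) real matrices with $J=-J^T$ and $R=R^T\ge 0$, and $H$ is a twice continuously differentiable real-valued function of the state $x$. Let $\bar u$ be a constant input and suppose there exists a corresponding steady state $\bar x$, i.e. $(J-R)\nabla H(\bar x)+g\bar u=0$, such that $\nabla^2H(\bar x)>0$. Then the system is passive in a neighborhood of $\bar x$ with respect to the shifted external port-variables $\tilde u:=u-\bar u$, $\tilde y:=y-\bar y$, where $\bar y:=g^T\nabla H(\bar x)$.
   Context: $\nabla^2H(\bar x)>0$ means that the Hessian of $H$ at $\bar x$ is positive definite. "Passive in a neighborhood of $\bar x$ with respect to $(\tilde u,\tilde y)$" means: there is a neighborhood $U$ of $\bar x$ and a continuously differentiable function $S:U\to[0,\infty)$ with $S(\bar x)=0$ (a local storage function) such that $\frac{d}{dt}S(x(t))\le \tilde u(t)^T\tilde y(t)$ along all trajectories of the system for as long as they remain in $U$. *)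

theory Defs
  imports "HOL-Analysis.Analysis"
begin

definition grad :: "(real^'n \<Rightarrow> real) \<Rightarrow> real^'n \<Rightarrow> real^'n" where
  "grad f x = (THE D. GDERIV f x :> D)"

definition hessian :: "(real^'n \<Rightarrow> real) \<Rightarrow> real^'n \<Rightarrow> real^'n^'n" where
  "hessian f x = jacobian (grad f) (at x)"

definition C1_on :: "(real^'n) set \<Rightarrow> (real^'n \<Rightarrow> real) \<Rightarrow> bool" where
  "C1_on U f \<longleftrightarrow> (\<forall>x\<in>U. f differentiable (at x)) \<and> continuous_on U (grad f)"

definition C2_on :: "(real^'n) set \<Rightarrow> (real^'n \<Rightarrow> real) \<Rightarrow> bool" where
  "C2_on U f \<longleftrightarrow> C1_on U f \<and> (\<forall>x\<in>U. grad f differentiable (at x))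
     \<and> continuous_on U (hessian f)"

text \<open>Definiteness concerns the quadratic form only. Symmetry is stated separately where it is
  not automatic; the Hessian of a \<open>C\<^sup>2\<close> function is symmetric by Schwarz's theorem.\<close>

definition pos_semidef :: "real^'n^'n \<Rightarrow> bool" where
  "pos_semidef A \<longleftrightarrow> (\<forall>v. 0 \<le> v \<bullet> (A *v v))"

definition pos_def :: "real^'n^'n \<Rightarrow> bool" where
  "pos_def A \<longleftrightarrow> (\<forall>v. v \<noteq> 0 \<longrightarrow> 0 < v \<bullet> (A *v v))"

text \<open>A trajectory of \<open>x' = F x u\<close> on a nondegenerate time interval \<open>T\<close> (open, closed or
  half-open, bounded or not; derivatives at endpoints in \<open>T\<close> are one-sided). The input signal is
  an arbitrary function of time.\<close>

definition trajectory ::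
  "(real^'n \<Rightarrow> real^'m \<Rightarrow> real^'n) \<Rightarrow> real set \<Rightarrow> (real \<Rightarrow> real^'n) \<Rightarrow> (real \<Rightarrow> real^'m) \<Rightarrow> bool" where
  "trajectory F T x u \<longleftrightarrow> is_interval T \<and> interior T \<noteq> {} \<and>
     (\<forall>t\<in>T. (x has_vector_derivative F (x t) (u t)) (at t within T))"

text \<open>The port variables \<open>v\<close> and \<open>w\<close> are given as functions of state and input.
  The values of \<open>S\<close> outside \<open>U\<close> are irrelevant, since \<open>U\<close> is open.\<close>

definition locally_passive ::
  "(real^'n \<Rightarrow> real^'m \<Rightarrow> real^'n) \<Rightarrow> real^'n \<Rightarrow>
   (real^'n \<Rightarrow> real^'m \<Rightarrow> real^'k) \<Rightarrow> (real^'n \<Rightarrow> real^'m \<Rightarrow> real^'k) \<Rightarrow> bool" where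
  "locally_passive F x0 v w \<longleftrightarrow>
     (\<exists>U S. open U \<and> x0 \<in> U \<and> C1_on U S \<and> (\<forall>x\<in>U. 0 \<le> S x) \<and> S x0 = 0 \<and>
        (\<forall>T x u. trajectory F T x u \<longrightarrow>
           (\<forall>t\<in>T. x t \<in> U \<longrightarrow>
              (\<exists>D. ((\<lambda>s. S (x s)) has_real_derivative D) (at t within T) \<and>
                   D \<le> v (x t) (u t) \<bullet> w (x t) (u t)))))"

definition ph_dynamics ::
  "real^'n^'n \<Rightarrow> real^'n^'n \<Rightarrow> real^'m^'n \<Rightarrow> (real^'n \<Rightarrow> real) \<Rightarrow> real^'n \<Rightarrow> real^'m \<Rightarrow> real^'n" where
  "ph_dynamics J R g H x u = (J - R) *v grad H x + g *v u"

definition ph_output :: "real^'m^'n \<Rightarrow> (real^'n \<Rightarrow> real) \<Rightarrow> real^'n \<Rightarrow> real^'m" where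
  "ph_output g H x = transpose g *v grad H x"

end

theory Submission imports Defs begin

text \<open>The storage function is the Bregman divergence of the Hamiltonian at the steady state,
  \<open>S x = H x - H xbar - (x - xbar) \<bullet> grad H xbar\<close>, also called the shifted Hamiltonian. Subtracting
  the tangent plane of \<open>H\<close> changes its gradient by a constant only, so
  \<open>grad S x = grad H x - grad H xbar =: z\<close>. Because \<open>J\<close>, \<open>R\<close>, \<open>g\<close> do not depend on the state,
  subtracting the steady-state equation turns the dynamics into
  \<open>x' = (J - R) z + g (u - ubar)\<close>, which is a port-Hamiltonian system with Hamiltonian \<open>S\<close> and output
  \<open>transpose g z = y - ybar\<close>. The usual power balance then gives passivity: \<open>J\<close> contributes nothing
  to \<open>z \<bullet> x'\<close>, and \<open>R\<close> contributes a nonpositive term (lemma \<open>ph_power_balance\<close>).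

  The Hessian enters only through nonnegativity of \<open>S\<close> near \<open>xbar\<close>. Positive definiteness makes
  \<open>(grad H x - grad H xbar) \<bullet> (x - xbar)\<close> nonnegative for \<open>x\<close> in a ball around \<open>xbar\<close>
  (lemma \<open>pos_def_derivative_local_monotone\<close>). Within that ball \<open>S\<close> therefore does
  not decrease along rays from \<open>xbar\<close>, where it vanishes (lemma \<open>bregman_nonneg\<close>).\<close>

lemma GDERIV_unique:
  assumes "GDERIV f x :> D" and "GDERIV f x :> E"
  shows "D = E"
proof -
  have "(\<lambda>h. h \<bullet> D) = (\<lambda>h. h \<bullet> E)"
    using assms has_derivative_unique unfolding gderiv_def by blast
  then show ?thesis
    by (metis vector_eq_ldot)
qed

lemma grad_eqI: "GDERIV f x :> D \<Longrightarrow> grad f x = D"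
  unfolding grad_def using GDERIV_unique by (metis the_equality)

text \<open>The Frechet derivative \<open>f'\<close> is a linear functional, so it has a Riesz representative; it is
  the value at \<open>1\<close> of the adjoint of \<open>f'\<close>.\<close>

lemma GDERIV_grad:
  fixes f :: "real^'n \<Rightarrow> real"
  assumes "f differentiable (at x)"
  shows "GDERIV f x :> grad f x"
proof -
  obtain f' where f': "(f has_derivative f') (at x)"
    using assms unfolding differentiable_def by blast
  interpret bounded_linear f' using f' by (rule has_derivative_bounded_linear)
  have "f' = (\<lambda>h. h \<bullet> adjoint f' 1)"
    using adjoint_works[OF linear_axioms, of _ 1] by (auto simp: fun_eq_iff)
  with f' have "GDERIV f x :> adjoint f' 1"
    unfolding gderiv_def by simp
  then show ?thesis
    using grad_eqI by metis
qed

text \<open>The constant is the minimum of the quadratic form on the unit sphere, which is compact; every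
  other vector is reduced to the sphere by homogeneity.\<close>

lemma pos_def_coercive:
  fixes A :: "real^'n^'n"
  assumes "pos_def A"
  obtains c where "c > 0" and "\<And>v. c * (norm v)\<^sup>2 \<le> v \<bullet> (A *v v)"
proof -
  have sphere: "compact (sphere (0::real^'n) 1)" "sphere (0::real^'n) 1 \<noteq> {}"
    by auto
  have "continuous_on (sphere 0 1) (\<lambda>v. v \<bullet> (A *v v))"
    by (intro continuous_intros linear_continuous_on bounded_linear_intros
        matrix_vector_mul_bounded_linear)
  then obtain w where w: "norm w = 1" and min: "\<And>v. norm v = 1 \<Longrightarrow> w \<bullet> (A *v w) \<le> v \<bullet> (A *v v)"
    using continuous_attains_inf[OF sphere] by (metis mem_sphere_0)
  show thesis
  proof
    show "0 < w \<bullet> (A *v w)"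
      using assms w unfolding pos_def_def by (metis norm_zero zero_neq_one)
    fix v :: "real^'n"
    show "(w \<bullet> (A *v w)) * (norm v)\<^sup>2 \<le> v \<bullet> (A *v v)"
    proof (cases "v = 0")
      case False
      define e where "e = v /\<^sub>R norm v"
      have v: "v = norm v *\<^sub>R e" and e: "norm e = 1"
        using False by (auto simp: e_def)
      have "v \<bullet> (A *v v) = (norm v)\<^sup>2 * (e \<bullet> (A *v e))"
        by (subst (1 2) v) (simp add: matrix_vector_mult_scaleR power2_eq_square)
      then show ?thesis
        using mult_right_mono[OF min[OF e], of "(norm v)\<^sup>2"] by (simp add: mult.commute)
    qed simp
  qed
qed

text \<open>The linear part of \<open>f x - f a\<close> pairs with \<open>x - a\<close> to at least \<open>c * (norm (x - a))\<^sup>2\<close>, and close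
  to \<open>a\<close> the remainder is too small to outweigh it. Differentiability at the single point \<open>a\<close>
  suffices because one of the two points compared is always \<open>a\<close>.\<close>

lemma pos_def_derivative_local_monotone:
  fixes f :: "real^'n \<Rightarrow> real^'n"
  assumes "(f has_derivative (\<lambda>h. A *v h)) (at a)" and "pos_def A"
  obtains r where "r > 0" and "\<And>x. x \<in> ball a r \<Longrightarrow> 0 \<le> (f x - f a) \<bullet> (x - a)"
proof -
  obtain c where c: "c > 0" "\<And>v. c * (norm v)\<^sup>2 \<le> v \<bullet> (A *v v)"
    using pos_def_coercive[OF assms(2)] by blast
  obtain r where r: "r > 0"
    "\<And>x. norm (x - a) < r \<Longrightarrow> norm (f x - f a - A *v (x - a)) \<le> c * norm (x - a)"
    using assms(1) c(1) unfolding has_derivative_at_alt by blast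
  show thesis
  proof (rule that[OF r(1)])
    fix x assume "x \<in> ball a r"
    then have near: "norm (x - a) < r"
      by (simp add: dist_norm norm_minus_commute)
    let ?d = "x - a" and ?e = "f x - f a - A *v (x - a)"
    have "- (?e \<bullet> ?d) \<le> norm ?e * norm ?d"
      using Cauchy_Schwarz_ineq2[of ?e ?d] by linarith
    also have "\<dots> \<le> c * (norm ?d)\<^sup>2"
      using mult_right_mono[OF r(2)[OF near], of "norm ?d"] by (simp add: power2_eq_square)
    also have "\<dots> \<le> ?d \<bullet> (A *v ?d)"
      by (rule c(2))
    finally have "0 \<le> ?e \<bullet> ?d + (A *v ?d) \<bullet> ?d"
      unfolding inner_commute[of ?d "A *v ?d"] by linarith
    then show "0 \<le> (f x - f a) \<bullet> ?d"
      by (simp only: inner_add_left[symmetric] diff_add_cancel)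
  qed
qed

definition bregman :: "(real^'n \<Rightarrow> real) \<Rightarrow> real^'n \<Rightarrow> real^'n \<Rightarrow> real" where
  "bregman H a x = H x - H a - (x - a) \<bullet> grad H a"

lemma GDERIV_bregman:
  assumes "H differentiable (at x)"
  shows "GDERIV (bregman H a) x :> grad H x - grad H a"
proof -
  have "(H has_derivative (\<lambda>h. h \<bullet> grad H x)) (at x)"
    using GDERIV_grad[OF assms] unfolding gderiv_def .
  then show ?thesis
    unfolding gderiv_def bregman_def[abs_def]
    by (auto intro!: derivative_eq_intros simp: inner_diff_right)
qed

text \<open>By the mean value theorem on the segment from \<open>a\<close> to \<open>x\<close>, the value \<open>bregman H a x\<close> is the
  derivative at some intermediate point \<open>p = a + s *\<^sub>R (x - a)\<close>, namely
  \<open>(grad H p - grad H a) \<bullet> (x - a)\<close>; multiplied by \<open>s > 0\<close> this is the hypothesis at \<open>p\<close>.\<close>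

lemma bregman_nonneg:
  assumes diff: "\<And>p. p \<in> ball a r \<Longrightarrow> H differentiable (at p)"
    and mono: "\<And>p. p \<in> ball a r \<Longrightarrow> 0 \<le> (grad H p - grad H a) \<bullet> (p - a)"
    and x: "x \<in> ball a r"
  shows "0 \<le> bregman H a x"
proof -
  define p where "p s = a + s *\<^sub>R (x - a)" for s
  have in_ball: "p s \<in> ball a r" if "0 \<le> s" "s \<le> 1" for s
  proof -
    have "s * norm (x - a) \<le> norm (x - a)"
      using that by (simp add: mult_left_le_one_le)
    then show ?thesis
      using x that by (simp add: p_def dist_norm norm_minus_commute)
  qed
  have deriv: "((\<lambda>s. bregman H a (p s)) has_derivative
      (\<lambda>h. h *\<^sub>R (x - a) \<bullet> (grad H (p s) - grad H a))) (at s)" if "0 \<le> s" "s \<le> 1" for s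
  proof -
    have "(p has_derivative (\<lambda>h. h *\<^sub>R (x - a))) (at s)"
      unfolding p_def by (auto intro!: derivative_eq_intros)
    then show ?thesis
      using GDERIV_bregman[OF diff[OF in_ball[OF that]]] unfolding gderiv_def
      by (rule has_derivative_compose)
  qed
  obtain s where s: "0 < s" "s < 1"
    and mvt: "bregman H a (p 1) - bregman H a (p 0) = (1 - 0) *\<^sub>R (x - a) \<bullet> (grad H (p s) - grad H a)"
    using mvt_simple[of 0 1, OF _ has_derivative_at_withinI[OF deriv]] by auto
  have "s * ((x - a) \<bullet> (grad H (p s) - grad H a)) \<ge> 0"
    using mono[OF in_ball[of s]] s by (simp add: p_def inner_commute)
  then have "0 \<le> (x - a) \<bullet> (grad H (p s) - grad H a)"
    using s by (simp add: zero_le_mult_iff)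
  moreover have "bregman H a (p 0) = 0" "bregman H a (p 1) = bregman H a x"
    by (simp_all add: p_def bregman_def)
  ultimately show ?thesis
    using mvt by simp
qed

lemma skew_form_zero:
  fixes J :: "real^'n^'n"
  assumes "J = - transpose J"
  shows "z \<bullet> (J *v z) = 0"
proof -
  have "z \<bullet> (J *v z) = (transpose J *v z) \<bullet> z"
    by (simp add: dot_lmul_matrix)
  also have "transpose J = - J"
    using assms by (metis minus_minus)
  also have "(- J *v z) \<bullet> z = - (z \<bullet> (J *v z))"
    using matrix_vector_mult_diff_rdistrib[of 0 J z] by (simp add: inner_commute)
  finally show ?thesis
    by simp
qed

text \<open>Along \<open>x' = (J - R) z + g v\<close> the stored energy, whose gradient is \<open>z\<close>, grows no faster than
  the power supplied through the port \<open>(v, transpose g z)\<close>.\<close>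

lemma ph_power_balance:
  fixes J R :: "real^'n^'n" and g :: "real^'m^'n"
  assumes "J = - transpose J" and "pos_semidef R"
  shows "((J - R) *v z + g *v v) \<bullet> z \<le> v \<bullet> (transpose g *v z)"
proof -
  have "(g *v v) \<bullet> z = v \<bullet> (transpose g *v z)"
    by (simp add: dot_lmul_matrix inner_commute[of v] inner_commute[of _ z])
  then have "((J - R) *v z + g *v v) \<bullet> z = z \<bullet> (J *v z) - z \<bullet> (R *v z) + v \<bullet> (transpose g *v z)"
    by (simp add: matrix_vector_mult_diff_rdistrib inner_commute[of _ z] inner_add_right
        inner_diff_right)
  then show ?thesis
    using skew_form_zero[OF assms(1)] assms(2) unfolding pos_semidef_def by simp
qed

lemma ph_dynamics_shifted:
  assumes "ph_dynamics J R g H a v = 0"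
  shows "ph_dynamics J R g H x u = (J - R) *v (grad H x - grad H a) + g *v (u - v)"
proof -
  have "ph_dynamics J R g H x u = ph_dynamics J R g H x u - ph_dynamics J R g H a v"
    using assms by simp
  then show ?thesis
    by (simp add: ph_dynamics_def matrix_vector_mult_diff_distrib)
qed

theorem proposition2:
  fixes J R :: "real^'n^'n" and g :: "real^'m^'n" and H :: "real^'n \<Rightarrow> real"
    and ubar :: "real^'m" and xbar :: "real^'n"
  assumes "J = - transpose J"
    and "R = transpose R"
    and "pos_semidef R"
    and "C2_on UNIV H"
    and "ph_dynamics J R g H xbar ubar = 0"
    and "pos_def (hessian H xbar)"
  shows "locally_passive (ph_dynamics J R g H) xbar
           (\<lambda>x u. u - ubar) (\<lambda>x u. ph_output g H x - ph_output g H xbar)"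
proof -
  let ?S = "bregman H xbar"
  let ?z = "\<lambda>x. grad H x - grad H xbar"
  have diff: "H differentiable (at x)" for x
    using assms(4) by (simp add: C2_on_def C1_on_def)
  have "grad H differentiable (at xbar)"
    using assms(4) by (simp add: C2_on_def)
  then have "(grad H has_derivative (\<lambda>h. hessian H xbar *v h)) (at xbar)"
    unfolding hessian_def using jacobian_works by blast
  then obtain r where r: "r > 0"
    and mono: "\<And>x. x \<in> ball xbar r \<Longrightarrow> 0 \<le> ?z x \<bullet> (x - xbar)"
    using pos_def_derivative_local_monotone[OF _ assms(6)] by blast
  have S_deriv: "(?S has_derivative (\<lambda>h. h \<bullet> ?z x)) (at x)" for x
    using GDERIV_bregman[OF diff] unfolding gderiv_def .
  have "grad ?S = ?z"
    using grad_eqI[OF GDERIV_bregman[OF diff]] by blast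
  moreover have "continuous_on (ball xbar r) ?z"
    using assms(4) unfolding C2_on_def C1_on_def
    by (auto intro!: continuous_intros intro: continuous_on_subset)
  ultimately have C1: "C1_on (ball xbar r) ?S"
    unfolding C1_on_def using S_deriv by (auto simp: differentiable_def)
  have dissipation: "\<exists>D. ((\<lambda>s. ?S (x s)) has_real_derivative D) (at t within T) \<and>
      D \<le> (u t - ubar) \<bullet> (ph_output g H (x t) - ph_output g H xbar)"
    if traj: "trajectory (ph_dynamics J R g H) T x u" and t: "t \<in> T" for T x u t
  proof (intro exI conjI)
    let ?x' = "ph_dynamics J R g H (x t) (u t)"
    have "(x has_derivative (\<lambda>h. h *\<^sub>R ?x')) (at t within T)"
      using traj t unfolding trajectory_def has_vector_derivative_def by blast
    from has_derivative_compose[OF this S_deriv]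
    show "((\<lambda>s. ?S (x s)) has_real_derivative ?x' \<bullet> ?z (x t)) (at t within T)"
      by (simp add: has_field_derivative_def mult_commute_abs)
    show "?x' \<bullet> ?z (x t) \<le> (u t - ubar) \<bullet> (ph_output g H (x t) - ph_output g H xbar)"
      using ph_power_balance[OF assms(1,3), of "?z (x t)" g "u t - ubar"]
      by (simp add: ph_dynamics_shifted[OF assms(5)] ph_output_def matrix_vector_mult_diff_distrib)
  qed
  have "?S xbar = 0"
    by (simp add: bregman_def)
  then show ?thesis
    unfolding locally_passive_def
    using r C1 bregman_nonneg[OF diff mono] dissipation
    by (intro exI[of _ "ball xbar r"] exI[of _ ?S]) auto
qed

end
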